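(* For all integers $n\ge1$ and $k\ge1$, $\mathfrak B_{2n}^{(-k)}\equiv 0\pmod 6$.
   Context: For an integer $k$, the poly-Bernoulli numbers with level $2$, $\mathfrak B_n^{(k)}$, are defined by the power series identity $$\sum_{n=0}^\infty\mathfrak B_n^{(k)}\frac{x^n}{n!}=\frac{{\rm Li}_{2,k}\bigl(2\sin(x/2)\bigr)}{2\sin(x/2)}=\sum_{m=0}^\infty\frac{\bigl(2\sin(x/2)\bigr)^{2m}}{(2m+1)^k},$$ where ${\rm Li}_{2,k}(z)=\sum_{n=0}^\infty\frac{z^{2n+1}}{(2n+1)^k}$. For $k\le 0$ these numbers are integers. *)

theory Defs
  imports "HOL-Computational_Algebra.Formal_Power_Series" "HOL-Number_Theory.Cong"
begin

definition Li2 :: "int \<Rightarrow> rat fps" where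
  "Li2 k = Abs_fps (\<lambda>n. if odd n then 1 / (of_nat n powi k) else 0)"

definition two_sin_half :: "rat fps" where
  "two_sin_half = fps_const 2 * fps_sin (1 / 2)"

text \<open>
  \<open>two_sin_half\<close> has subdegree 1, so it is not a unit; the division below is the
  exact division of formal power series (both arguments are divisible by \<open>fps_X\<close>),
  see \<open>polyB2_egf_altdef\<close>.
\<close>

definition polyB2_egf :: "int \<Rightarrow> rat fps" where
  "polyB2_egf k = (Li2 k oo two_sin_half) / two_sin_half"

definition polyB2 :: "int \<Rightarrow> nat \<Rightarrow> rat" where
  "polyB2 k n = fact n * fps_nth (polyB2_egf k) n"

lemma two_sin_half_nth_0 [simp]: "fps_nth two_sin_half 0 = 0"
  by (simp add: two_sin_half_def)

lemma two_sin_half_nonzero [simp]: "two_sin_half \<noteq> 0"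
proof
  assume "two_sin_half = 0"
  then have "fps_nth two_sin_half 1 = 0" by simp
  then show False by (simp add: two_sin_half_def fps_sin_def)
qed

lemma polyB2_egf_altdef:
  "polyB2_egf k =
     Abs_fps (\<lambda>i. if even i then 1 / (of_nat (i + 1) powi k) else 0) oo two_sin_half"
    (is "_ = ?R oo _")
proof -
  have "Li2 k = fps_X * ?R"
    by (rule fps_ext) (auto simp: Li2_def)
  then have "Li2 k oo two_sin_half = two_sin_half * (?R oo two_sin_half)"
    by (simp add: fps_compose_mult_distrib)
  then show ?thesis
    by (simp add: polyB2_egf_def)
qed

text \<open>The sum over \<open>m\<close> may be truncated at \<open>m = n\<close>, since
  \<open>two_sin_half ^ (2 * m)\<close> has subdegree \<open>2 * m\<close>.\<close>

lemma polyB2_egf_nth: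
  "fps_nth (polyB2_egf k) n =
     (\<Sum>m\<le>n. 1 / (of_nat (2 * m + 1) powi k) * fps_nth (two_sin_half ^ (2 * m)) n)"
proof -
  let ?f = "\<lambda>i. (if even i then 1 / (of_nat (i + 1) powi k) else 0) * fps_nth (two_sin_half ^ i) n"
  have "fps_nth (polyB2_egf k) n = (\<Sum>i\<in>{0..n}. ?f i)"
    by (simp add: polyB2_egf_altdef fps_compose_nth)
  also have "\<dots> = (\<Sum>i\<in>{0..2 * n}. ?f i)"
    by (rule sum.mono_neutral_left) (auto intro!: startsby_zero_power_prefix[rule_format])
  also have "\<dots> = (\<Sum>i\<in>(\<lambda>m. 2 * m) ` {..n}. ?f i)"
    by (rule sum.mono_neutral_right) (auto elim!: evenE)
  also have "\<dots> = (\<Sum>m\<le>n. ?f (2 * m))"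
    by (subst sum.reindex) (auto simp: inj_on_def)
  finally show ?thesis
    by simp
qed

end

theory Submission
  imports Defs
begin

text \<open>
  The powers of \<open>s = 2 sin (x/2)\<close> satisfy
  \<open>(s\<^sup>2\<^sup>m\<^sup>+\<^sup>2)'' = (2m+2)(2m+1) s\<^sup>2\<^sup>m - (m+1)\<^sup>2 s\<^sup>2\<^sup>m\<^sup>+\<^sup>2\<close>, so that the numbers
  \<open>T(n,m) = (2n)! [x\<^sup>2\<^sup>n] s\<^sup>2\<^sup>m\<close> are integers obeying a two-term recurrence. After multiplying
  the recurrence for \<open>T(n+1,m+1)\<close> by \<open>2m+3\<close>, its first term contains the three consecutive
  factors \<open>(2m+3)(2m+2)(2m+1)\<close>; hence \<open>6\<close> divides \<open>(2m+1) T(n,m)\<close>, and a fortiori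
  \<open>(2m+1)\<^sup>k T(n,m)\<close> for \<open>k \<ge> 1\<close>, whenever \<open>(n,m) \<noteq> (0,0)\<close>.
\<close>

text \<open>Up to the factor \<open>(-1)^(n+m) * (2*m)!\<close>, these are the central factorial
  numbers with even indices.\<close>

fun two_sin_half_power_coeff :: "nat \<Rightarrow> nat \<Rightarrow> int" where
  "two_sin_half_power_coeff 0 0 = 1"
| "two_sin_half_power_coeff 0 (Suc m) = 0"
| "two_sin_half_power_coeff (Suc n) 0 = 0"
| "two_sin_half_power_coeff (Suc n) (Suc m) =
     (2 * int m + 2) * (2 * int m + 1) * two_sin_half_power_coeff n m
     - (int m + 1)\<^sup>2 * two_sin_half_power_coeff n (Suc m)"

lemma fps_deriv_two_sin_half: "fps_deriv two_sin_half = fps_cos (1 / 2)"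
proof -
  have "fps_deriv two_sin_half = (fps_const 2 * fps_const (1 / 2)) * fps_cos (1 / 2)"
    by (simp only: two_sin_half_def fps_deriv_mult fps_deriv_const fps_sin_deriv mult_zero_left
        add_0_right mult.assoc)
  then show ?thesis
    by (simp del: fps_const_divide)
qed

lemma fps_deriv_fps_cos_half:
  "fps_deriv (fps_cos (1 / 2)) = - fps_const (1 / 4) * two_sin_half"
  by (rule fps_ext) (simp add: fps_cos_deriv two_sin_half_def)

lemma fps_cos_half_square:
  "(fps_cos (1 / 2))\<^sup>2 = 1 - fps_const (1 / 4) * two_sin_half\<^sup>2"
proof -
  have "fps_const (1 / 4) * two_sin_half\<^sup>2 = (fps_sin (1 / 2))\<^sup>2"
    by (rule fps_ext) (simp add: two_sin_half_def power_mult_distrib fps_const_power)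
  then show ?thesis
    using fps_sin_cos_sum_of_squares[of "1 / 2 :: rat"] by (simp add: algebra_simps)
qed

text \<open>Each differentiation of a power of \<open>s\<close> brings out the cosine; the second
  one also differentiates it. The resulting \<open>c\<^sup>2\<close> is eliminated by
  Pythagoras.\<close>

lemma fps_deriv_deriv_two_sin_half_power:
  "fps_deriv (fps_deriv (two_sin_half ^ (2 * Suc m))) =
     fps_const ((2 * of_nat m + 2) * (2 * of_nat m + 1)) * two_sin_half ^ (2 * m)
     - fps_const ((of_nat m + 1)\<^sup>2) * two_sin_half ^ (2 * Suc m)"
proof -
  let ?s = two_sin_half and ?c = "fps_cos (1 / 2) :: rat fps"
  let ?a = "2 * of_nat m + 2 :: rat" and ?b = "2 * of_nat m + 1 :: rat"
  have deriv_even: "fps_deriv (?s ^ (2 * Suc m)) = fps_const ?a * (?c * ?s ^ (2 * m + 1))"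
    by (simp add: fps_deriv_power fps_deriv_two_sin_half ac_simps fps_of_nat[symmetric]
        del: power_Suc)
  have deriv_odd: "fps_deriv (?s ^ (2 * m + 1)) = fps_const ?b * (?c * ?s ^ (2 * m))"
    by (simp add: fps_deriv_power fps_deriv_two_sin_half ac_simps fps_of_nat[symmetric]
        del: power_Suc)
  \<comment> \<open>Stated for arbitrary series, so that \<open>simp\<close> treats constants and
    powers as opaque; the left side has the shape that the product rule yields.\<close>
  have "A * (?c * (B * (?c * x)) + - Q * ?s * y) = A * (B * ?c\<^sup>2 * x - Q * (?s * y))"
    for A B Q x y :: "rat fps"
    by (simp add: power2_eq_square algebra_simps)
  then have "fps_deriv (fps_deriv (?s ^ (2 * Suc m))) =
      fps_const ?a * (fps_const ?b * ?c\<^sup>2 * ?s ^ (2 * m) - fps_const (1 / 4) * (?s * ?s ^ (2 * m + 1)))"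
    by (simp only: deriv_even deriv_odd fps_deriv_mult fps_deriv_const fps_deriv_fps_cos_half
        mult_zero_left add_0_right)
  also have "\<dots> = fps_const (?a * ?b) * ?s ^ (2 * m)
      - fps_const (?a * ?b * (1 / 4) + ?a * (1 / 4)) * ?s ^ (2 * Suc m)"
  proof -
    have "A * (B * (1 - Q * ?s\<^sup>2) * x - Q * (?s * (?s * x))) =
        A * B * x - (A * B * Q + A * Q) * (?s\<^sup>2 * x)" for A B Q x :: "rat fps"
      by (simp add: power2_eq_square algebra_simps)
    moreover have "?s ^ (2 * m + 1) = ?s * ?s ^ (2 * m)" "?s ^ (2 * Suc m) = ?s\<^sup>2 * ?s ^ (2 * m)"
      by (simp_all add: power2_eq_square)
    ultimately show ?thesis
      by (simp only: fps_cos_half_square fps_const_mult fps_const_add)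
  qed
  \<comment> \<open>Since \<open>?b + 1 = ?a\<close>, the left side is
    \<open>?a\<^sup>2 / 4\<close>.\<close>
  also have "?a * ?b * (1 / 4) + ?a * (1 / 4) = (of_nat m + 1)\<^sup>2"
    by (simp add: power2_eq_square field_simps)
  finally show ?thesis .
qed

text \<open>Differentiating twice shifts the coefficients weighted by factorials down by two places,
  so the differential equation becomes the recurrence.\<close>

lemma fact_mult_nth_two_sin_half_power:
  "fact (2 * n) * fps_nth (two_sin_half ^ (2 * m)) (2 * n) =
     of_int (two_sin_half_power_coeff n m)"
proof (induction n m rule: two_sin_half_power_coeff.induct)
  case (4 n m)
  let ?f = "two_sin_half ^ (2 * Suc m)"
  have "fact (2 * Suc n) * fps_nth ?f (2 * Suc n) =
      fact (2 * n) * fps_nth (fps_deriv (fps_deriv ?f)) (2 * n)"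
    by (simp add: algebra_simps del: power_Suc)
  also have "\<dots> = (2 * of_nat m + 2) * (2 * of_nat m + 1) *
        (fact (2 * n) * fps_nth (two_sin_half ^ (2 * m)) (2 * n))
      - (of_nat m + 1)\<^sup>2 * (fact (2 * n) * fps_nth ?f (2 * n))"
    unfolding fps_deriv_deriv_two_sin_half_power
    by (simp only: fps_sub_nth fps_mult_left_const_nth) (simp only: algebra_simps)
  finally show ?case
    unfolding 4 by simp
qed (simp_all add: fps_nth_power_0)

lemma six_dvd_mult_two_sin_half_power_coeff:
  "n > 0 \<or> m > 0 \<Longrightarrow> 6 dvd (2 * int m + 1) * two_sin_half_power_coeff n m"
proof (induction n m rule: two_sin_half_power_coeff.induct)
  case (4 n m)
  have "6 dvd (2 * int m + 3) * (2 * int m + 2) * (2 * int m + 1)"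
  proof -
    have "even ((2 * int m + 3) * (2 * int m + 2) * (2 * int m + 1))"
      by simp
    moreover have "3 dvd (2 * int m + 3) * (2 * int m + 2) * (2 * int m + 1)"
    proof -
      have "3 dvd 2 * int m + 3 \<or> 3 dvd 2 * int m + 2 \<or> 3 dvd 2 * int m + 1"
        by presburger
      then show ?thesis
        by auto
    qed
    moreover have "6 dvd x" if "even x" "3 dvd x" for x :: int
      using that by presburger
    ultimately show ?thesis
      by blast
  qed
  then have "6 dvd (2 * int m + 3) * (2 * int m + 2) * (2 * int m + 1) * two_sin_half_power_coeff n m"
    by (rule dvd_mult2)
  \<comment> \<open>The induction hypothesis at \<open>(n, Suc m)\<close> applies because
    \<open>Suc m > 0\<close>. The first product is divisible for any coefficient, which covers
    \<open>n = m = 0\<close>.\<close>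
  moreover have "6 dvd (int m + 1)\<^sup>2 * ((2 * int (Suc m) + 1) * two_sin_half_power_coeff n (Suc m))"
    using 4(2) by (subst dvd_mult) simp_all
  ultimately have "6 dvd (2 * int m + 3) * (2 * int m + 2) * (2 * int m + 1) * two_sin_half_power_coeff n m
      - (int m + 1)\<^sup>2 * ((2 * int (Suc m) + 1) * two_sin_half_power_coeff n (Suc m))"
    by (rule dvd_diff)
  then show ?case
    by (simp add: algebra_simps)
qed simp_all

theorem theorem11:
  fixes n :: nat and k :: int
  assumes "n \<ge> 1" and "k \<ge> 1"
  shows "\<exists>b::int. polyB2 (- k) (2 * n) = of_int b \<and> [b = 0] (mod 6)"
proof -
  \<comment> \<open>The negative index turns \<open>1 / (2*m+1) powi (-k)\<close> into a positive
    power. The bound \<open>2 * n\<close> comes from truncating at the coefficient's index; terms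
    with \<open>m > n\<close> vanish.\<close>
  define b where
    "b = (\<Sum>m\<le>2 * n. (2 * int m + 1) ^ nat k * two_sin_half_power_coeff n m)"
  have "polyB2 (- k) (2 * n) = (\<Sum>m\<le>2 * n. (2 * of_nat m + 1) ^ nat k *
      (fact (2 * n) * fps_nth (two_sin_half ^ (2 * m)) (2 * n)))"
    using \<open>k \<ge> 1\<close>
    by (simp add: polyB2_def polyB2_egf_nth sum_distrib_left power_int_def field_simps)
  also have "\<dots> = of_int b"
    unfolding fact_mult_nth_two_sin_half_power b_def by simp
  finally have "polyB2 (- k) (2 * n) = of_int b" .
  moreover have "6 dvd (2 * int m + 1) ^ nat k * two_sin_half_power_coeff n m" for m
  proof -
    \<comment> \<open>As \<open>k \<ge> 1\<close>, the power contains at least one factor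
      \<open>2*m+1\<close>.\<close>
    have "(2 * int m + 1) * two_sin_half_power_coeff n m dvd
        (2 * int m + 1) ^ nat k * two_sin_half_power_coeff n m"
      using \<open>k \<ge> 1\<close> by (intro mult_dvd_mono dvd_power) auto
    then show ?thesis
      using six_dvd_mult_two_sin_half_power_coeff[of n m] \<open>n \<ge> 1\<close> by (auto intro: dvd_trans)
  qed
  then have "6 dvd b"
    unfolding b_def by (intro dvd_sum) auto
  ultimately show ?thesis
    by (auto simp: cong_0_iff)
qed

end
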